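(* Let $\mathbb{K}=\mathbb{R}$ or $\mathbb{C}$, and let $w=(w_i)_{i\in\mathbb{Z}}$ be any sequence of nonzero scalars in $\mathbb{K}$. Let $\mathbb{K}^{\mathbb{Z}}$ carry the product topology. Then the bilateral weighted forward shift $F_w:\mathbb{K}^{\mathbb{Z}}\to\mathbb{K}^{\mathbb{Z}}$ defined by \[ (F_wx)_j=w_{j-1}\,x_{j-1}\quad(j\in\mathbb{Z}) \] has the shadowing property.
   Context: No boundedness assumption is made on $w$ or $1/w$. For a Fréchet space $X$, $GL(X)$ denotes the set of linear homeomorphisms of $X$ onto itself. The operator $F_w$ belongs to $GL(\mathbb{K}^{\mathbb{Z}})$, with inverse $(F_w^{-1}x)_j=x_{j+1}/w_j$. Shadowing property: let $X$ be a Fréchet space and $T\in GL(X)$. For a neighborhood $U$ of $0$, a $U$-pseudotrajectory of $T$ is a sequence $(x_n)_{n\in\mathbb{Z}}$ in $X$ with $x_{n+1}-Tx_n\in U$ for all $n\in\mathbb{Z}$. $T$ has the shadowing property if for every neighborhood $V$ of $0$ there is a neighborhood $U$ of $0$ such that for every $U$-pseudotrajectory $(x_n)_{n\in\mathbb{Z}}$ of $T$ there is $x\in X$ with $x_n-T^nx\in V$ for all $n\in\mathbb{Z}$. *)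

theory Defs
  imports "HOL-Analysis.Analysis" "HOL-Library.Function_Algebras"
begin

text \<open>The topology on the type \<open>int \<Rightarrow> 'k\<close> is the product topology of
  \<open>HOL-Analysis.Function_Topology\<close>; addition, subtraction and zero are the pointwise ones of
  \<open>HOL-Library.Function_Algebras\<close>. The scalar action has no class instance, so it is passed
  explicitly.\<close>

definition seq_scale :: "'k::field \<Rightarrow> (int \<Rightarrow> 'k) \<Rightarrow> (int \<Rightarrow> 'k)" where
  "seq_scale c x = (\<lambda>j. c * x j)"

definition GL :: "('k::field \<Rightarrow> 'a \<Rightarrow> 'a) \<Rightarrow> ('a::{topological_space,ab_group_add} \<Rightarrow> 'a) set" where
  "GL s = {T. Vector_Spaces.linear s s T \<and> (\<exists>S. homeomorphism UNIV UNIV T S)}"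

definition iterate :: "('a \<Rightarrow> 'a) \<Rightarrow> int \<Rightarrow> 'a \<Rightarrow> 'a" where
  "iterate T n = (if n \<ge> 0 then T ^^ nat n else (inv T) ^^ nat (- n))"

definition pseudotrajectory ::
    "('a::ab_group_add \<Rightarrow> 'a) \<Rightarrow> 'a set \<Rightarrow> (int \<Rightarrow> 'a) \<Rightarrow> bool" where
  "pseudotrajectory T U x \<longleftrightarrow> (\<forall>n. x (n + 1) - T (x n) \<in> U)"

text \<open>Neighborhoods of 0 need not be open. Membership in \<open>GL\<close> is part of the definition, so that
  the negative iterates are those of a genuine inverse. Beyond that only the underlying topological
  group of the space is involved.\<close>

definition shadowing_property ::
    "('k::field \<Rightarrow> 'a \<Rightarrow> 'a) \<Rightarrow> ('a::{topological_space,ab_group_add} \<Rightarrow> 'a) \<Rightarrow> bool" where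
  "shadowing_property s T \<longleftrightarrow> T \<in> GL s \<and>
    (\<forall>V. (\<forall>\<^sub>F v in nhds 0. v \<in> V) \<longrightarrow>
      (\<exists>U. (\<forall>\<^sub>F u in nhds 0. u \<in> U) \<and>
        (\<forall>x. pseudotrajectory T U x \<longrightarrow> (\<exists>y. \<forall>n. x n - iterate T n y \<in> V))))"

definition forward_shift :: "(int \<Rightarrow> 'k::field) \<Rightarrow> (int \<Rightarrow> 'k) \<Rightarrow> (int \<Rightarrow> 'k)" where
  "forward_shift w x = (\<lambda>j. w (j - 1) * x (j - 1))"

lemma forward_shift_in_GL:
  fixes w :: "int \<Rightarrow> 'k::real_normed_field"
  assumes "\<And>i. w i \<noteq> 0"
  shows "forward_shift w \<in> GL seq_scale"
    and "inv (forward_shift w) = (\<lambda>x j. x (j + 1) / w j)"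
proof -
  let ?S = "\<lambda>(x :: int \<Rightarrow> 'k) j. x (j + 1) / w j"
  have TS: "forward_shift w (?S x) = x" and ST: "?S (forward_shift w x) = x" for x
    using assms by (auto simp: forward_shift_def)
  have lin: "Vector_Spaces.linear seq_scale seq_scale (forward_shift w)"
    by unfold_locales (auto simp: seq_scale_def forward_shift_def algebra_simps plus_fun_def)
  have contT: "continuous_on UNIV (forward_shift w)"
    unfolding forward_shift_def
    by (intro continuous_on_coordinatewise_then_product continuous_intros
        continuous_on_product_coordinates)
  have contS: "continuous_on UNIV ?S"
    using assms
    by (intro continuous_on_coordinatewise_then_product continuous_intros
        continuous_on_product_coordinates) auto
  have "homeomorphism UNIV UNIV (forward_shift w) ?S"
    using TS ST contT contS by (intro homeomorphismI) auto
  with lin show "forward_shift w \<in> GL seq_scale"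
    by (auto simp: GL_def)
  show "inv (forward_shift w) = ?S"
    by (rule inv_equality) (use TS ST in auto)
qed

end

theory Submission
  imports Defs
begin

text \<open>Choose \<open>p\<close> with \<open>p 0 = 1\<close> and \<open>p (j + 1) = w j * p j\<close>. Then
  \<open>q n j = p j * x (n - j) 0\<close> is an exact trajectory that agrees with \<open>x\<close> at coordinate \<open>0\<close>,
  at all times. The difference \<open>d n j\<close> of \<open>x\<close> and \<open>q\<close> obeys \<open>d (n + 1) (j + 1) = w j * d n j + z\<close>,
  where \<open>z\<close> is the coordinate \<open>j + 1\<close> of the error of \<open>x\<close> at time \<open>n\<close>. So \<open>d\<close> at a given
  coordinate \<open>j\<close> only depends on the errors at the finitely many coordinates between \<open>0\<close> and \<open>j\<close>,
  and it is small uniformly in \<open>n\<close>.\<close>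

text \<open>The value at time 0 determines a two-sided exact trajectory: bijectivity turns the step
  from \<open>m - 1\<close> to \<open>m\<close> into a step back under \<open>inv T\<close>, which
  covers negative times.\<close>

lemma iterate_trajectory:
  assumes "bij T" and step: "\<And>n. T (q n) = q (n + 1)"
  shows "iterate T n (q 0) = q n"
proof -
  have fwd: "(T ^^ k) (q 0) = q (int k)" for k
    by (induction k) (simp_all add: step add.commute)
  have inv_step: "inv T (q m) = q (m - 1)" for m
    using step[of "m - 1"] \<open>bij T\<close> by (metis bij_inv_eq_iff diff_add_cancel)
  have bwd: "(inv T ^^ k) (q 0) = q (- int k)" for k
    by (induction k) (simp_all add: inv_step minus_diff_commute)
  show ?thesis
    using fwd[of "nat n"] bwd[of "nat (- n)"] by (auto simp: iterate_def)
qed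

lemma weight_product_exists:
  fixes w :: "int \<Rightarrow> 'k::field"
  assumes "\<And>i. w i \<noteq> 0"
  obtains p where "p 0 = 1" and "\<And>j. p (j + 1) = w j * p j"
proof -
  \<comment> \<open>For negative \<open>j\<close> the recursion is solved backwards by dividing by
    weights. The branches meet at \<open>j = -1\<close>, where \<open>j + 1 = 0\<close> gives the
    empty product.\<close>
  let ?p = "\<lambda>j. if j \<ge> 0 then prod w {0..<j} else inverse (prod w {j..<0})"
  have "?p (j + 1) = w j * ?p j" for j
  proof (cases "j \<ge> 0")
    case True
    then have "{0..<j + 1} = insert j {0..<j}" by auto
    with True show ?thesis by simp
  next
    case False
    then have "{j..<0} = insert j {j + 1..<0}" by auto
    with False assms show ?thesis by (auto simp: field_simps)
  qed
  then show thesis by (intro that[of ?p]) simp_all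
qed

lemma eventually_nhds_fun_coordinate:
  fixes f :: "'a \<Rightarrow> 'b::topological_space"
  assumes "eventually P (nhds (f j))"
  shows "\<forall>\<^sub>F g in nhds f. P (g j)"
proof -
  have "continuous_on UNIV (\<lambda>g::'a \<Rightarrow> 'b. g j)"
    by (rule continuous_on_product_coordinates)
  then have "(\<lambda>g. g j) \<midarrow>f\<rightarrow> f j"
    by (simp add: continuous_on_def)
  then have "((\<lambda>g. g j) \<longlongrightarrow> f j) (nhds f)"
    by (rule tendsto_at_iff_tendsto_nhds[THEN iffD1])
  with assms show ?thesis
    by (simp add: filterlim_iff)
qed

text \<open>A basic open set of the product topology restricts only finitely many coordinates, so
  the least of finitely many radii serves them all.\<close>

lemma nhds_fun_contains_box:
  fixes f :: "'a \<Rightarrow> 'b::metric_space"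
  assumes "\<forall>\<^sub>F g in nhds f. g \<in> V"
  obtains I e where "finite I" "e > 0" "\<And>g. (\<And>j. j \<in> I \<Longrightarrow> dist (g j) (f j) < e) \<Longrightarrow> g \<in> V"
proof -
  obtain S where S: "open S" "f \<in> S" "S \<subseteq> V"
    using assms by (auto simp: eventually_nhds)
  then have "openin (product_topology (\<lambda>_. euclidean) UNIV) S"
    by (simp add: open_fun_def)
  then obtain X where X: "f \<in> (\<Pi>\<^sub>E i\<in>UNIV. X i)" "\<And>i. open (X i)"
      "finite {i. X i \<noteq> UNIV}" "(\<Pi>\<^sub>E i\<in>UNIV. X i) \<subseteq> S"
    using product_topology_open_contains_basis[of "\<lambda>_. euclidean" UNIV S f] S(2) by auto
  define I where "I = {i. X i \<noteq> UNIV}"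
  have "\<exists>e>0. \<forall>y. dist y (f i) < e \<longrightarrow> y \<in> X i" for i
    using X(1) X(2)[of i] by (auto simp: open_dist PiE_iff)
  then obtain r where r: "\<And>i. r i > 0" "\<And>i y. dist y (f i) < r i \<Longrightarrow> y \<in> X i"
    by metis
  have fin: "finite I" using X(3) by (simp add: I_def)
  \<comment> \<open>The extra 1 keeps the minimum meaningful when \<open>I\<close> is empty.\<close>
  define e where "e = Min (insert 1 (r ` I))"
  show thesis
  proof
    show "finite I" by (rule fin)
    show "e > 0" using fin r(1) by (auto simp: e_def)
    fix g assume g: "\<And>j. j \<in> I \<Longrightarrow> dist (g j) (f j) < e"
    have "g i \<in> X i" for i
    proof (cases "i \<in> I")
      case True
      then have "e \<le> r i" using fin by (simp add: e_def)
      with g[OF True] show ?thesis by (intro r(2)) simp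
    qed (simp add: I_def)
    then show "g \<in> V" using X(4) S(3) by auto
  qed
qed

lemma pseudotrajectory_mono:
  "pseudotrajectory T U x \<Longrightarrow> U \<subseteq> U' \<Longrightarrow> pseudotrajectory T U' x"
  by (auto simp: pseudotrajectory_def)

lemma forward_shift_coordinate_estimate:
  fixes w :: "int \<Rightarrow> 'k::real_normed_field"
  assumes w: "\<And>i. w i \<noteq> 0" and p: "p 0 = 1" "\<And>j. p (j + 1) = w j * p j"
    and "e > 0"
  shows "\<exists>U. (\<forall>\<^sub>F u in nhds 0. u \<in> U) \<and>
    (\<forall>x. pseudotrajectory (forward_shift w) U x \<longrightarrow> (\<forall>n. norm (x n j - p j * x (n - j) 0) < e))"
proof -
  define d :: "(int \<Rightarrow> int \<Rightarrow> 'k) \<Rightarrow> int \<Rightarrow> int \<Rightarrow> 'k"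
    where "d x n j = x n j - p j * x (n - j) 0" for x n j
  define z :: "(int \<Rightarrow> int \<Rightarrow> 'k) \<Rightarrow> int \<Rightarrow> int \<Rightarrow> 'k"
    where "z x n = x (n + 1) - forward_shift w (x n)" for x n
  \<comment> \<open>Passing to \<open>(n + 1, j + 1)\<close> leaves \<open>n - j\<close> unchanged,
    so the terms with \<open>p\<close> cancel.\<close>
  have rec: "d x (n + 1) (j + 1) = w j * d x n j + z x n (j + 1)" for x n j
    by (simp add: d_def z_def forward_shift_def p(2)) (simp add: algebra_simps)
  have ball: "\<forall>\<^sub>F u in nhds (0 :: int \<Rightarrow> 'k). u \<in> {u. norm (u j) < r}" if "r > 0" for r j
  proof -
    have "\<forall>\<^sub>F v in nhds (0 :: 'k). norm v < r"
      using that by (auto simp: eventually_nhds_metric)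
    then show ?thesis
      using eventually_nhds_fun_coordinate[of "\<lambda>v. norm v < r" "0 :: int \<Rightarrow> 'k" j] by simp
  qed
  \<comment> \<open>The induction runs outward from coordinate 0. It keeps all radii and all times,
    since each step rescales the radius by a weight and shifts the time.\<close>
  have "\<forall>e>0. \<exists>U. (\<forall>\<^sub>F u in nhds 0. u \<in> U) \<and>
    (\<forall>x. pseudotrajectory (forward_shift w) U x \<longrightarrow> (\<forall>n. norm (d x n j) < e))"
  proof (induction j rule: int_induct[where k = 0])
    case base
    \<comment> \<open>At coordinate 0 the deviation vanishes identically.\<close>
    show ?case using p(1) by (auto simp: d_def intro!: exI[of _ UNIV])
  next
    case (step1 j)
    show ?case
    proof (intro allI impI)
      fix e :: real assume "e > 0"
      \<comment> \<open>Half of \<open>e\<close> is reserved for the old deviation after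
        multiplication by \<open>w j\<close>, half for the new error.\<close>
      then have "e / 2 / norm (w j) > 0" using w by simp
      with step1 obtain U where U: "\<forall>\<^sub>F u in nhds 0. u \<in> U"
        "\<And>x n. pseudotrajectory (forward_shift w) U x \<Longrightarrow> norm (d x n j) < e / 2 / norm (w j)"
        by metis
      let ?U = "U \<inter> {u. norm (u (j + 1)) < e / 2}"
      have "norm (d x n (j + 1)) < e" if "pseudotrajectory (forward_shift w) ?U x" for x n
      proof -
        have "norm (d x (n - 1) j) < e / 2 / norm (w j)"
          by (rule U(2), rule pseudotrajectory_mono[OF that]) simp
        then have "norm (w j * d x (n - 1) j) < e / 2"
          using w by (simp add: norm_mult field_simps)
        moreover have "norm (z x (n - 1) (j + 1)) < e / 2"
          using that unfolding pseudotrajectory_def z_def by blast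
        ultimately show ?thesis
          using rec[of x "n - 1" j] norm_triangle_ineq[of "w j * d x (n - 1) j" "z x (n - 1) (j + 1)"]
          by simp
      qed
      moreover have "\<forall>\<^sub>F u in nhds 0. u \<in> ?U"
        using U(1) ball[of "e / 2" "j + 1"] \<open>e > 0\<close> by (simp add: eventually_conj)
      ultimately show "\<exists>U. (\<forall>\<^sub>F u in nhds 0. u \<in> U) \<and>
          (\<forall>x. pseudotrajectory (forward_shift w) U x \<longrightarrow> (\<forall>n. norm (d x n (j + 1)) < e))"
        by blast
    qed
  next
    case (step2 j)
    show ?case
    proof (intro allI impI)
      fix e :: real assume "e > 0"
      \<comment> \<open>Going down, the recursion is solved for \<open>d x n (j - 1)\<close>. Two
        terms below \<open>r\<close> sum to less than \<open>e * norm (w (j - 1))\<close>, which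
        absorbs the division by \<open>w (j - 1)\<close>.\<close>
      define r where "r = e * norm (w (j - 1)) / 2"
      have "r > 0" using w \<open>e > 0\<close> by (simp add: r_def)
      with step2 obtain U where U: "\<forall>\<^sub>F u in nhds 0. u \<in> U"
        "\<And>x n. pseudotrajectory (forward_shift w) U x \<Longrightarrow> norm (d x n j) < r"
        by metis
      let ?U = "U \<inter> {u. norm (u j) < r}"
      have "norm (d x n (j - 1)) < e" if "pseudotrajectory (forward_shift w) ?U x" for x n
      proof -
        have "norm (d x (n + 1) j) < r"
          by (rule U(2), rule pseudotrajectory_mono[OF that]) simp
        moreover have "norm (z x n j) < r"
          using that unfolding pseudotrajectory_def z_def by blast
        moreover have "w (j - 1) * d x n (j - 1) = d x (n + 1) j - z x n j"
          using rec[of x n "j - 1"] by simp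
        ultimately have "norm (w (j - 1) * d x n (j - 1)) < e * norm (w (j - 1))"
          using norm_triangle_ineq4[of "d x (n + 1) j" "z x n j"] by (simp add: r_def)
        then show ?thesis using w by (simp add: norm_mult mult.commute)
      qed
      moreover have "\<forall>\<^sub>F u in nhds 0. u \<in> ?U"
        using U(1) ball[of r j] \<open>r > 0\<close> by (simp add: eventually_conj)
      ultimately show "\<exists>U. (\<forall>\<^sub>F u in nhds 0. u \<in> U) \<and>
          (\<forall>x. pseudotrajectory (forward_shift w) U x \<longrightarrow> (\<forall>n. norm (d x n (j - 1)) < e))"
        by blast
    qed
  qed
  with \<open>e > 0\<close> show ?thesis by (simp add: d_def)
qed

text \<open>Only the finitely many coordinates that \<open>V\<close> restricts need control, so the
  neighborhoods found for them can be intersected.\<close>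

lemma forward_shift_shadowing:
  fixes w :: "int \<Rightarrow> 'k::real_normed_field"
  assumes w: "\<And>i. w i \<noteq> 0"
  shows "shadowing_property seq_scale (forward_shift w)"
  unfolding shadowing_property_def
proof (intro conjI allI impI)
  show GL: "forward_shift w \<in> GL seq_scale"
    using w by (rule forward_shift_in_GL)
  then obtain S where "homeomorphism UNIV UNIV (forward_shift w) S"
    by (auto simp: GL_def)
  then have bij: "bij (forward_shift w)"
    by (intro bij_betw_byWitness[of _ S]) (auto simp: homeomorphism_def)
  obtain p where p: "p 0 = 1" "\<And>j. p (j + 1) = w j * p j"
    using weight_product_exists w by blast
  fix V :: "(int \<Rightarrow> 'k) set" assume "\<forall>\<^sub>F v in nhds 0. v \<in> V"
  then obtain I e where I: "finite I" "e > 0"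
    and V: "\<And>v. (\<And>j. j \<in> I \<Longrightarrow> dist (v j) (0 j) < e) \<Longrightarrow> v \<in> V"
    by (rule nhds_fun_contains_box) blast
  obtain U where U: "\<And>j. \<forall>\<^sub>F u in nhds 0. u \<in> U j"
    "\<And>j x n. pseudotrajectory (forward_shift w) (U j) x \<Longrightarrow> norm (x n j - p j * x (n - j) 0) < e"
    using forward_shift_coordinate_estimate[OF w p I(2)] by metis
  have "\<exists>y. \<forall>n. x n - iterate (forward_shift w) n y \<in> V"
    if x: "pseudotrajectory (forward_shift w) (\<Inter>j\<in>I. U j) x" for x
  proof (intro exI allI)
    \<comment> \<open>The shadowing point is \<open>q 0\<close>, with coordinates
      \<open>p j * x (- j) 0\<close>.\<close>
    define q where "q n = (\<lambda>j. p j * x (n - j) 0)" for n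
    have "forward_shift w (q n) = q (n + 1)" for n
    proof
      fix j
      show "forward_shift w (q n) j = q (n + 1) j"
        using p(2)[of "j - 1"] by (simp add: forward_shift_def q_def algebra_simps)
    qed
    then have "iterate (forward_shift w) n (q 0) = q n" for n
      by (rule iterate_trajectory[OF bij])
    moreover have "x n - q n \<in> V" for n
    proof (rule V)
      fix j assume "j \<in> I"
      then have "pseudotrajectory (forward_shift w) (U j) x"
        by (intro pseudotrajectory_mono[OF x]) auto
      then show "dist ((x n - q n) j) (0 j) < e"
        by (simp add: q_def U(2))
    qed
    ultimately show "x n - iterate (forward_shift w) n (q 0) \<in> V" for n
      by simp
  qed
  moreover have "\<forall>\<^sub>F u in nhds 0. u \<in> (\<Inter>j\<in>I. U j)"
    using I(1) U(1) by (simp add: eventually_ball_finite)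
  ultimately show "\<exists>U. (\<forall>\<^sub>F u in nhds 0. u \<in> U) \<and>
      (\<forall>x. pseudotrajectory (forward_shift w) U x \<longrightarrow>
        (\<exists>y. \<forall>n. x n - iterate (forward_shift w) n y \<in> V))"
    by blast
qed

theorem theorem2:
  shows "(\<forall>w :: int \<Rightarrow> real. (\<forall>i. w i \<noteq> 0) \<longrightarrow>
            shadowing_property seq_scale (forward_shift w)) \<and>
         (\<forall>w :: int \<Rightarrow> complex. (\<forall>i. w i \<noteq> 0) \<longrightarrow>
            shadowing_property seq_scale (forward_shift w))"
  by (simp add: forward_shift_shadowing)

end
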